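(* Let $(\mathcal{X},d)$ be a complete metric space and $f\colon\mathcal{X}\to\mathbb{R}\cup\{\pm\infty\}$ a closed function. Suppose that there is a nonempty open set $\mathcal{U}\subseteq\mathcal{X}$ such that $$(f(x)-f^* )^{\theta}\leq\alpha\cdot|\nabla f|(x)\quad\text{for all } x\in\mathcal{U}\cap[f^*<f<r],$$ where $\theta\in(0,1)$, $\alpha>0$, $f^*$, and $r>f^*$ are real numbers. Then there exist a nonempty open set $\widehat{\mathcal{U}}\subseteq\mathcal{X}$ and a real number $\hat r>f^*$ such that $$\operatorname{dist}(x;[f\leq f^*])\leq\frac{\alpha^{1/\theta}}{1-\theta}\cdot\big(|\nabla f|(x)\big)^{\frac{1-\theta}{\theta}}\quad\text{for all } x\in\widehat{\mathcal{U}}\cap[f^*<f<\hat r].$$ In the case $\mathcal{U}=\mathcal{X}$, one can take $\widehat{\mathcal{U}}=\mathcal{X}$ and $\hat r=r$.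
   Context: A function on a metric space is called closed if it is lower-semicontinuous. Notation: $[f\leq b]:=\{x: f(x)\leq b\}$, $[a<f<b]:=\{x: a<f(x)<b\}$, and $\operatorname{dist}(x;Q)=\inf_{y\in Q}d(x,y)$ (equal to $+\infty$ if $Q=\emptyset$). The slope of $f$ at a point $\bar x$ with $f(\bar x)$ finite is $|\nabla f|(\bar x):=\limsup_{x\to\bar x,\,x\ne\bar x}\frac{(f(\bar x)-f(x))^+}{d(\bar x,x)}\in[0,+\infty]$, where $r^+=\max\{0,r\}$ (it is $0$ if $\bar x$ is isolated). *)

theory Defs
  imports "HOL-Analysis.Analysis"
begin

definition closed_fun :: "('a::metric_space \<Rightarrow> ereal) \<Rightarrow> bool" where
  "closed_fun f \<longleftrightarrow> (\<forall>x. f x \<le> Liminf (at x) f)"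

(* Only meaningful where f is finite.  At an isolated point the filter "at x" is trivial and
   Limsup would be -\<infinity> there, so the value 0 has to be given separately. *)
definition slope :: "('a::metric_space \<Rightarrow> ereal) \<Rightarrow> 'a \<Rightarrow> ereal" where
  "slope f x =
     (if at x = bot then 0
      else Limsup (at x) (\<lambda>y. max 0 (f x - f y) / ereal (dist x y)))"

(* An extended-real version of infdist: infdist x {} = 0, whereas here the
   distance to the empty set is \<infinity> (infimum of the empty set in ereal). *)
definition edist_to :: "'a::metric_space \<Rightarrow> 'a set \<Rightarrow> ereal" where
  "edist_to x Q = (INF y\<in>Q. ereal (dist x y))"

(* Powers of elements of [0,\<infinity>] with positive real exponent. *)
definition epowr :: "ereal \<Rightarrow> real \<Rightarrow> ereal" where
  "epowr x p = (if x = \<infinity> then \<infinity> else ereal (real_of_ereal x powr p))"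

end

theory Submission
  imports Defs
begin

text \<open>By concavity of \<open>t \<mapsto> t powr (1 - \<theta>)\<close>, the hypothesis says that
  \<open>g = (f - f*) powr (1 - \<theta>)\<close> has slope at least \<open>(1 - \<theta>) / \<alpha>\<close> where \<open>f* < f < r\<close>.
  If the distance from \<open>x\<close> to \<open>[f \<le> f*]\<close> exceeded \<open>\<alpha> / (1 - \<theta>) * g x\<close>, Ekeland's principle
  would give a nearby point with \<open>f > f*\<close> and smaller slope.  So the distance is
  at most \<open>\<alpha> / (1 - \<theta>) * g x\<close>, and the hypothesis at \<open>x\<close> itself bounds \<open>g x\<close> by a power of the
  slope.  In the local version \<open>f*\<close> is approached closely enough that the Ekeland point cannot
  leave \<open>U\<close>.\<close>

section \<open>Ekeland's variational principle\<close>

lemma ekeland: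
  fixes g :: "'a::complete_space \<Rightarrow> real"
  assumes lsc: "\<And>x c. c < g x \<Longrightarrow> eventually (\<lambda>z. c < g z) (nhds x)"
    and nonneg: "\<And>x. 0 \<le> g x" and K: "0 < K"
  obtains y where "g y + K * dist x y \<le> g x"
    and "\<And>z. z \<noteq> y \<Longrightarrow> g y < g z + K * dist y z"
proof -
  \<comment> \<open>\<open>v \<in> S u\<close> is a reflexive and transitive relation: a move from
    \<open>u\<close> to \<open>v\<close> is paid for by a decrease of \<open>g\<close>. A chain of
    moves to near-minimisers converges, because the convergent values of \<open>g\<close> control
    the distances, and its limit admits no further move.\<close>
  define S where "S x = {y. g y + K * dist x y \<le> g x}" for x
  have S_refl: "x \<in> S x" for x
    by (simp add: S_def)
  have S_trans: "w \<in> S u" if "v \<in> S u" "w \<in> S v" for u v w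
  proof -
    have "K * dist u w \<le> K * (dist u v + dist v w)"
      using K by (intro mult_left_mono dist_triangle) auto
    then show ?thesis
      using that by (simp add: S_def distrib_left)
  qed
  have bdd: "bdd_below (g ` S u)" for u
    using nonneg by (intro bdd_belowI[of _ 0]) auto
  have "\<exists>v. v \<in> S u \<and> g v < Inf (g ` S u) + inverse (real (Suc n))" for u n
    using cInf_lessD[of "g ` S u" "Inf (g ` S u) + inverse (real (Suc n))"] S_refl[of u] by auto
  \<comment> \<open>The invariant \<open>n = 0 \<longrightarrow> u = x\<close> pins the start of the
    chain to \<open>x\<close>.\<close>
  then have "\<exists>X. \<forall>n. (X 0 = x) \<and> X (Suc n) \<in> S (X n)
      \<and> g (X (Suc n)) < Inf (g ` S (X n)) + inverse (real (Suc n))"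
    using dependent_nat_choice[of "\<lambda>n u. n = 0 \<longrightarrow> u = x"
        "\<lambda>n u v. v \<in> S u \<and> g v < Inf (g ` S u) + inverse (real (Suc n))"]
    by (metis nat.distinct(1))
  then obtain X where X0: "X 0 = x" and XS: "\<And>n. X (Suc n) \<in> S (X n)"
    and Xinf: "\<And>n. g (X (Suc n)) < Inf (g ` S (X n)) + inverse (real (Suc n))"
    by blast
  have chain: "X m \<in> S (X n)" if "n \<le> m" for n m
    using that by (induction m rule: dec_induct) (auto intro: S_refl S_trans XS)
  then have chain': "g (X m) + K * dist (X n) (X m) \<le> g (X n)" if "n \<le> m" for n m
    using that by (simp add: S_def)
  have "decseq (\<lambda>n. g (X n))"
    using chain' K unfolding decseq_def by (smt (verit) mult_nonneg_nonneg zero_le_dist)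
  then have conv: "convergent (\<lambda>n. g (X n))"
    by (rule decseq_convergent[where B = 0]) (use nonneg in \<open>auto intro: convergentI\<close>)
  have "Cauchy X"
  proof (rule metric_CauchyI)
    fix e :: real assume "0 < e"
    then obtain M where M: "\<And>m n. M \<le> m \<Longrightarrow> M \<le> n \<Longrightarrow> dist (g (X m)) (g (X n)) < K * e"
      using convergent_Cauchy[OF conv] K unfolding Cauchy_def by (metis mult_pos_pos)
    have *: "dist (X n) (X m) < e" if "M \<le> n" "n \<le> m" for m n
    proof -
      have "K * dist (X n) (X m) < K * e"
        using chain'[OF that(2)] M[of n m] that unfolding dist_real_def by linarith
      then show ?thesis using K by simp
    qed
    then show "\<exists>M. \<forall>m\<ge>M. \<forall>n\<ge>M. dist (X m) (X n) < e"
      by (metis dist_commute nle_le)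
  qed
  then obtain y where y: "X \<longlonglongrightarrow> y"
    using Cauchy_convergent convergent_def by blast
  \<comment> \<open>Pass to the limit in \<open>chain'\<close>. Semicontinuity bounds
    \<open>g (X m)\<close> from below only by \<open>g y - e\<close>, hence the slack
    \<open>e\<close>.\<close>
  have yS: "y \<in> S (X n)" for n
  proof -
    have "g y \<le> g (X n) - K * dist (X n) y + e" if "0 < e" for e
    proof -
      have "eventually (\<lambda>m. g y - e < g (X m)) sequentially"
        using eventually_compose_filterlim[OF lsc y, of "g y - e"] that by simp
      then have ev: "eventually (\<lambda>m. K * dist (X n) (X m) \<le> g (X n) - (g y - e)) sequentially"
        using eventually_ge_at_top[of n]
      proof eventually_elim
        case (elim m)
        then show ?case using chain'[of n m] by linarith
      qed
      have "(\<lambda>m. K * dist (X n) (X m)) \<longlonglongrightarrow> K * dist (X n) y"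
        by (intro tendsto_intros y)
      from tendsto_upperbound[OF this ev] show ?thesis by simp
    qed
    from field_le_epsilon[OF this] show ?thesis
      by (simp add: S_def)
  qed
  show thesis
  proof
    show "g y + K * dist x y \<le> g x"
      using yS[of 0] by (simp add: X0 S_def)
  next
    fix z assume "z \<noteq> y"
    show "g y < g z + K * dist y z"
    proof (rule ccontr)
      assume "\<not> ?thesis"
      then have "z \<in> S y" by (simp add: S_def)
      \<comment> \<open>By transitivity \<open>z\<close> lies in every \<open>S (X n)\<close>, so
        \<open>g z\<close> is at least the infimum that \<open>g (X (Suc n))\<close> nearly attains.
        In the limit \<open>g y \<le> g z\<close>, so a move from \<open>y\<close> to
        \<open>z\<close> is not paid for.\<close>
      have "g y \<le> g z + inverse (real (Suc n))" for n
      proof -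
        have "Inf (g ` S (X n)) \<le> g z"
          using S_trans[OF yS \<open>z \<in> S y\<close>] bdd by (intro cInf_lower) auto
        moreover have "0 \<le> K * dist (X (Suc n)) y" using K by simp
        ultimately show ?thesis
          using Xinf[of n] yS[of "Suc n"] by (simp add: S_def)
      qed
      moreover have "(\<lambda>n. g z + inverse (real (Suc n))) \<longlonglongrightarrow> g z + 0"
        by (intro tendsto_intros LIMSEQ_inverse_real_of_nat)
      ultimately have "g y \<le> g z"
        using LIMSEQ_le_const by fastforce
      moreover have "0 < K * dist y z" using K \<open>z \<noteq> y\<close> by simp
      ultimately show False using \<open>z \<in> S y\<close> by (simp add: S_def)
    qed
  qed
qed

section \<open>Semicontinuity, slopes and concavity of powers\<close>

lemma closed_funD:
  assumes "closed_fun f" "c < f x"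
  shows "eventually (\<lambda>z. c < f z) (nhds x)"
proof -
  have "f x \<le> Liminf (at x) f"
    using assms by (simp add: closed_fun_def)
  then have "eventually (\<lambda>z. c < f z) (at x)"
    using assms(2) by (simp add: le_Liminf_iff)
  then show ?thesis
    unfolding eventually_at_filter by (rule eventually_mono) (use assms(2) in auto)
qed

lemma slope_le:
  assumes "eventually (\<lambda>z. max 0 (f x - f z) / ereal (dist x z) \<le> C) (at x)" "0 \<le> C"
  shows "slope f x \<le> C"
  \<comment> \<open>\<open>0 \<le> C\<close> settles isolated points, where the slope is 0 by
    convention.\<close>
  using assms by (simp add: slope_def Limsup_bounded)

text \<open>A concave function lies below its tangents. Scaling by \<open>a\<close> reduces this to
  Bernoulli's inequality for \<open>b / a\<close>, which is concavity of \<open>ln\<close> between 1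
  and \<open>b / a\<close>. It turns a bound on the decrease of a power of \<open>f - f*\<close>
  into one on the decrease of \<open>f\<close>.\<close>

lemma powr_le_tangent:
  fixes a b p :: real
  assumes "0 < a" "0 \<le> b" "0 < p" "p < 1"
  shows "b powr p \<le> a powr p + p * a powr (p - 1) * (b - a)"
proof (cases "b = 0")
  case True
  have "a powr (p - 1) * a = a powr p"
    using assms by (simp add: powr_diff)
  moreover have "p * a powr p \<le> 1 * a powr p"
    using assms by (intro mult_right_mono) auto
  ultimately show ?thesis
    using True assms by (simp add: algebra_simps)
next
  case False
  have "p * ln (b / a) + (1 - p) * 0 \<le> ln (1 + p * (b / a - 1))"
  proof -
    have "concave_on {0<..} (ln :: real \<Rightarrow> real)" by (rule ln_concave)
    from concave_onD[OF this, of p 1 "b / a"] show ?thesis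
      using assms False by (simp add: algebra_simps)
  qed
  then have "exp (p * ln (b / a)) \<le> exp (ln (1 + p * (b / a - 1)))" by simp
  moreover have "0 < 1 + p * (b / a - 1)"
  proof -
    have "0 \<le> p * (b / a)" using assms by simp
    then show ?thesis using assms unfolding right_diff_distrib by linarith
  qed
  ultimately have "(b / a) powr p \<le> 1 + p * (b / a - 1)"
    using assms False by (simp add: powr_def)
  then have "a powr p * (b / a) powr p \<le> a powr p * (1 + p * (b / a - 1))"
    by (intro mult_left_mono) auto
  then show ?thesis
    using assms by (simp add: powr_divide powr_diff field_simps)
qed

section \<open>The distance estimate by values of the function\<close>

lemma edist_sublevel_le:
  fixes f :: "'a::complete_space \<Rightarrow> ereal" and \<theta> \<alpha> c r R a :: real
  assumes f: "closed_fun f" and \<theta>: "0 < \<theta>" "\<theta> < 1" and \<alpha>: "0 < \<alpha>"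
    and slope: "\<And>y. y \<in> ball x R \<Longrightarrow> ereal c < f y \<Longrightarrow> f y < ereal r \<Longrightarrow>
      epowr (f y - ereal c) \<theta> \<le> ereal \<alpha> * slope f y"
    and x: "f x = ereal (c + a)" "0 < a" "c + a < r"
    and R: "\<alpha> / (1 - \<theta>) * a powr (1 - \<theta>) < R"
  shows "edist_to x {y. f y \<le> ereal c} \<le> ereal (\<alpha> / (1 - \<theta>) * a powr (1 - \<theta>))"
proof (rule ccontr)
  define p where "p = 1 - \<theta>"
  have p: "0 < p" "p < 1" using \<theta> by (auto simp: p_def)
  assume "\<not> ?thesis"
  then have "ereal (\<alpha> / p * a powr p) < min (edist_to x {y. f y \<le> ereal c}) (ereal R)"
    using R by (simp add: p_def)
  \<comment> \<open>The Ekeland point will be within \<open>E\<close> of \<open>x\<close>: too close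
    to lie in the sublevel set, and still in the ball where the slope inequality is assumed.\<close>
  then obtain E where E: "\<alpha> / p * a powr p < E" "ereal E < edist_to x {y. f y \<le> ereal c}" "E < R"
    by (metis ereal_dense2 less_ereal.simps(1) min_less_iff_conj)
  have "0 < \<alpha> / p * a powr p" using p \<alpha> x by simp
  then have "0 < E" using E by simp
  \<comment> \<open>Chosen so that \<open>K * E = g x\<close>, which gives
    \<open>dist x y \<le> E\<close>. The lower bound on \<open>E\<close> becomes
    \<open>\<alpha> * K < p\<close>, the source of the final contradiction.\<close>
  define K where "K = a powr p / E"
  have K: "0 < K" using x \<open>0 < E\<close> by (simp add: K_def)
  have K\<alpha>: "\<alpha> * K < p"
    using E(1) \<open>0 < E\<close> p by (simp add: K_def field_simps)
  \<comment> \<open>Ekeland's principle needs a real-valued nonnegative function, while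
    \<open>f\<close> may be infinite or below \<open>c\<close>. Truncation to \<open>[c, r]\<close>
    keeps semicontinuity and changes nothing where the slope inequality applies.\<close>
  define t where "t z = real_of_ereal (min (max (f z) (ereal c)) (ereal r)) - c" for z
  have t: "ereal (c + t z) = min (max (f z) (ereal c)) (ereal r)" for z
    by (cases "f z") (auto simp: t_def min_def max_def)
  have t_nonneg: "0 \<le> t z" for z
  proof -
    have "ereal c \<le> ereal (c + t z)" unfolding t using x by auto
    then show ?thesis by simp
  qed
  have t_eq: "f z = ereal (c + t z)" if "c \<le> f z" "f z \<le> r" for z
    using that by (simp add: t)
  have tx: "t x = a" using t_eq[of x] x by simp
  define g where "g z = t z powr p" for z
  have lsc: "eventually (\<lambda>z. b < g z) (nhds y)" if "b < g y" for b y
  proof (cases "b < 0")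
    case True
    then show ?thesis
      by (auto simp: g_def intro!: always_eventually less_le_trans[OF _ powr_ge_zero])
  next
    case False
    \<comment> \<open>The threshold for \<open>t\<close> that corresponds to \<open>b\<close> for
      \<open>g\<close>. Since \<open>c + s < r\<close>, the truncation at \<open>r\<close> does not
      interfere.\<close>
    define s where "s = b powr (1 / p)"
    have s: "0 \<le> s" "s powr p = b" using False p by (auto simp: s_def powr_powr)
    have "s < t y"
      using that s p t_nonneg[of y] powr_mono2[of p "t y" s] unfolding g_def by linarith
    then have "ereal (c + s) < min (max (f y) (ereal c)) (ereal r)"
      unfolding t[symmetric] by simp
    then have sr: "ereal (c + s) < f y" "c + s < r"
      using s by (auto simp: less_max_iff_disj)
    from closed_funD[OF f sr(1)] show ?thesis
    proof eventually_elim
      case (elim z)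
      then have "ereal (c + s) < ereal (c + t z)"
        unfolding t using sr by (simp add: less_max_iff_disj)
      then show ?case
        using s p powr_less_mono2[of p s "t z"] by (simp add: g_def)
    qed
  qed
  obtain y where y: "g y + K * dist x y \<le> g x"
    and ymin: "\<And>z. z \<noteq> y \<Longrightarrow> g y < g z + K * dist y z"
    using ekeland[OF lsc _ K, of x] by (auto simp: g_def)
  have "K * E = g x" using \<open>0 < E\<close> by (simp add: K_def g_def tx)
  moreover have "0 \<le> g y" by (simp add: g_def)
  ultimately have "K * dist x y \<le> K * E" using y by linarith
  then have dE: "dist x y \<le> E" using K by simp
  then have yR: "y \<in> ball x R" using E by simp
  have yc: "ereal c < f y"
  proof (rule ccontr)
    assume "\<not> ?thesis"
    then have "edist_to x {y. f y \<le> ereal c} \<le> ereal (dist x y)"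
      unfolding edist_to_def by (intro INF_lower) auto
    also have "\<dots> \<le> ereal E" using dE by simp
    finally show False using E(2) by simp
  qed
  have "0 \<le> K * dist x y" using K by simp
  then have "t y powr p \<le> a powr p" using y by (simp add: g_def tx)
  then have "t y \<le> a"
    using powr_less_mono2[of p a "t y"] p x by (meson not_less less_imp_le)
  then have "ereal (c + t y) < ereal r" using x by simp
  then have yr: "f y < ereal r" unfolding t by (auto simp: min_less_iff_disj)
  define u where "u = t y"
  have fy: "f y = ereal (c + u)" using t_eq[of y] yc yr by (simp add: u_def)
  have u: "0 < u" using yc fy by simp
  \<comment> \<open>Dividing the rate \<open>K\<close> for \<open>g\<close> by the derivative
    \<open>p * u powr (p - 1)\<close> of the power gives the rate for \<open>f\<close>, as
    \<open>p - 1 = -\<theta>\<close>.\<close>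
  define C where "C = K * u powr \<theta> / p"
  have "0 \<le> C" using K p by (simp add: C_def)
  have "eventually (\<lambda>z. ereal c < f z) (at y)"
    using closed_funD[OF f yc] by (simp add: eventually_at_filter eventually_mono)
  then have "eventually (\<lambda>z. max 0 (f y - f z) / ereal (dist y z) \<le> ereal C) (at y)"
    using eventually_neq_at_within[of y y UNIV]
  proof eventually_elim
    case (elim z)
    have d: "0 < dist y z" using elim by simp
    show ?case
    proof (cases "f y \<le> f z")
      case True
      then have "f y - f z \<le> 0" using fy by (cases "f z") auto
      then have "max 0 (f y - f z) = 0" by (simp add: max_def)
      then show ?thesis using \<open>0 \<le> C\<close> by simp
    next
      case False
      define v where "v = t z"
      have "f z < ereal r" using False yr by auto
      then have fz: "f z = ereal (c + v)" using t_eq[of z] elim by (simp add: v_def)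
      have v: "0 \<le> v" "v < u" using False fz fy t_nonneg[of z] by (auto simp: v_def)
      have "p * u powr (p - 1) * (u - v) \<le> g y - g z"
        using powr_le_tangent[OF u v(1) p] by (simp add: g_def u_def v_def algebra_simps)
      also have "\<dots> \<le> K * dist y z" using ymin[of z] elim by simp
      finally have "u powr \<theta> * (p * u powr (p - 1) * (u - v)) \<le> u powr \<theta> * (K * dist y z)"
        by (intro mult_left_mono) auto
      moreover have "u powr \<theta> * u powr (p - 1) = 1"
        using u by (simp add: p_def powr_add[symmetric])
      ultimately have "p * (u - v) \<le> u powr \<theta> * (K * dist y z)"
        by (simp add: algebra_simps)
      then have "(u - v) / dist y z \<le> C"
        using d p by (simp add: C_def field_simps)
      then show ?thesis using fy fz v d by (simp add: max_def)
    qed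
  qed
  then have "slope f y \<le> ereal C"
    using \<open>0 \<le> C\<close> by (intro slope_le) auto
  then have "ereal \<alpha> * slope f y \<le> ereal \<alpha> * ereal C"
    using \<alpha> by (intro ereal_mult_left_mono) auto
  with slope[OF yR yc yr] have "epowr (f y - ereal c) \<theta> \<le> ereal \<alpha> * ereal C"
    by (rule order_trans)
  \<comment> \<open>The slope inequality at \<open>y\<close> now contradicts
    \<open>\<alpha> * K < p\<close>.\<close>
  then have "u powr \<theta> \<le> \<alpha> * C"
    by (simp add: fy epowr_def)
  also have "\<dots> = (\<alpha> * K) / p * u powr \<theta>" by (simp add: C_def)
  also have "\<dots> < 1 * u powr \<theta>"
    using K\<alpha> p u by (intro mult_strict_right_mono) auto
  finally show False by simp
qed

text \<open>Raise the hypothesis to the power \<open>(1 - \<theta>) / \<theta>\<close>. The extra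
  factor \<open>\<alpha>\<close> makes its exponent
  \<open>1 + (1 - \<theta>) / \<theta> = 1 / \<theta>\<close>.\<close>

lemma powr_le_epowr_slope:
  fixes \<theta> \<alpha> a :: real
  assumes \<theta>: "0 < \<theta>" "\<theta> < 1" and \<alpha>: "0 < \<alpha>" and a: "0 < a"
    and le: "epowr (ereal a) \<theta> \<le> ereal \<alpha> * s"
  shows "ereal (\<alpha> / (1 - \<theta>) * a powr (1 - \<theta>))
    \<le> ereal (\<alpha> powr (1 / \<theta>) / (1 - \<theta>)) * epowr s ((1 - \<theta>) / \<theta>)"
proof (cases s)
  case (real q)
  have aq: "a powr \<theta> \<le> \<alpha> * q" using le real by (simp add: epowr_def)
  then have "0 < \<alpha> * q" using a by (smt (verit) powr_gt_zero)
  then have q: "0 < q" using \<alpha> by (simp add: zero_less_mult_iff)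
  have "a powr (1 - \<theta>) = (a powr \<theta>) powr ((1 - \<theta>) / \<theta>)"
    using \<theta> by (simp add: powr_powr)
  also have "\<dots> \<le> (\<alpha> * q) powr ((1 - \<theta>) / \<theta>)"
    using aq \<theta> by (intro powr_mono2) auto
  finally have "\<alpha> * a powr (1 - \<theta>) \<le> \<alpha> * (\<alpha> powr ((1 - \<theta>) / \<theta>) * q powr ((1 - \<theta>) / \<theta>))"
    using \<alpha> q by (intro mult_left_mono) (auto simp: powr_mult)
  also have "\<dots> = \<alpha> powr (1 + (1 - \<theta>) / \<theta>) * q powr ((1 - \<theta>) / \<theta>)"
    using \<alpha> by (simp add: powr_add)
  also have "1 + (1 - \<theta>) / \<theta> = 1 / \<theta>"
    using \<theta> by (simp add: field_simps)
  finally show ?thesis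
    using real \<theta> by (simp add: epowr_def divide_right_mono)
next
  case PInf
  then show ?thesis using \<theta> \<alpha> by (simp add: epowr_def)
next
  case MInf
  then show ?thesis using le \<alpha> by (simp add: epowr_def)
qed

section \<open>Local and global error bounds\<close>

theorem theorem3p7:
  fixes f :: "'a::complete_space \<Rightarrow> ereal"
    and U :: "'a set"
    and \<theta> \<alpha> fstar r :: real
  assumes "closed_fun f"
    and "open U" and "U \<noteq> {}"
    and "0 < \<theta>" and "\<theta> < 1" and "0 < \<alpha>" and "fstar < r"
    and "\<forall>x \<in> U \<inter> {x. ereal fstar < f x \<and> f x < ereal r}.
           epowr (f x - ereal fstar) \<theta> \<le> ereal \<alpha> * slope f x"
  shows "(\<exists>V rhat. open V \<and> V \<noteq> {} \<and> fstar < rhat \<and>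
            (\<forall>x \<in> V \<inter> {x. ereal fstar < f x \<and> f x < ereal rhat}.
               edist_to x {y. f y \<le> ereal fstar}
                 \<le> ereal (\<alpha> powr (1 / \<theta>) / (1 - \<theta>)) * epowr (slope f x) ((1 - \<theta>) / \<theta>)))
       \<and> (U = UNIV \<longrightarrow>
            (\<forall>x \<in> {x. ereal fstar < f x \<and> f x < ereal r}.
               edist_to x {y. f y \<le> ereal fstar}
                 \<le> ereal (\<alpha> powr (1 / \<theta>) / (1 - \<theta>)) * epowr (slope f x) ((1 - \<theta>) / \<theta>)))"
proof -
  let ?D = "\<lambda>a. \<alpha> / (1 - \<theta>) * a powr (1 - \<theta>)"
  have finite_value: "\<exists>a. f x = ereal (fstar + a) \<and> 0 < a \<and> fstar + a < r"
    if "ereal fstar < f x" "f x < ereal r" for x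
  proof (cases "f x")
    case (real q)
    then show ?thesis using that by (intro exI[of _ "q - fstar"]) auto
  qed (use that in auto)
  have bound: "edist_to x {y. f y \<le> ereal fstar}
      \<le> ereal (\<alpha> powr (1 / \<theta>) / (1 - \<theta>)) * epowr (slope f x) ((1 - \<theta>) / \<theta>)"
    if x: "f x = ereal (fstar + a)" "0 < a" "fstar + a < r"
      and R: "?D a < R" "ball x R \<subseteq> U" for x a R
  proof -
    have "edist_to x {y. f y \<le> ereal fstar} \<le> ereal (?D a)"
      using assms(1,4-6,8) x R by (intro edist_sublevel_le[where R = R and r = r]) auto
    also have "\<dots> \<le> ereal (\<alpha> powr (1 / \<theta>) / (1 - \<theta>)) * epowr (slope f x) ((1 - \<theta>) / \<theta>)"
    proof (rule powr_le_epowr_slope)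
      have "0 < ?D a" using assms(4-6) x by simp
      then have "x \<in> U" using R by (auto simp: subset_iff)
      then show "epowr (ereal a) \<theta> \<le> ereal \<alpha> * slope f x"
        using assms(8) x by force
    qed (use assms x in auto)
    finally show ?thesis .
  qed
  obtain x0 e where e: "0 < e" "ball x0 e \<subseteq> U"
    using assms(2,3) open_contains_ball by blast
  \<comment> \<open>Half the radius, so that \<open>ball x \<rho>\<close> stays in \<open>U\<close>
    for every \<open>x\<close> in \<open>ball x0 \<rho>\<close>.\<close>
  define \<rho> where "\<rho> = e / 2"
  have \<rho>: "0 < \<rho>" using e by (simp add: \<rho>_def)
  \<comment> \<open>The solution of \<open>?D \<delta> = \<rho>\<close>: values less than
    \<open>\<delta>\<close> above \<open>fstar\<close> have distance bound below
    \<open>\<rho>\<close>.\<close>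
  define \<delta> where "\<delta> = (\<rho> * (1 - \<theta>) / \<alpha>) powr (1 / (1 - \<theta>))"
  have \<delta>: "0 < \<delta>" "?D \<delta> = \<rho>"
    using \<rho> assms(4-6) by (auto simp: \<delta>_def powr_powr)
  have "edist_to x {y. f y \<le> ereal fstar}
      \<le> ereal (\<alpha> powr (1 / \<theta>) / (1 - \<theta>)) * epowr (slope f x) ((1 - \<theta>) / \<theta>)"
    if x: "x \<in> ball x0 \<rho>" "ereal fstar < f x" "f x < ereal (min r (fstar + \<delta>))" for x
  proof -
    have "f x < ereal r" using x(3) by (rule less_le_trans) simp
    then obtain a where a: "f x = ereal (fstar + a)" "0 < a" "fstar + a < r"
      using finite_value x(2) by blast
    then have "a powr (1 - \<theta>) < \<delta> powr (1 - \<theta>)"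
      using x assms(5) by (intro powr_less_mono2) auto
    then have "?D a < ?D \<delta>"
      using assms(5,6) by (intro mult_strict_left_mono) auto
    moreover have "ball x \<rho> \<subseteq> ball x0 e"
    proof
      fix z assume "z \<in> ball x \<rho>"
      then show "z \<in> ball x0 e"
        using x(1) dist_triangle[of x0 z x] by (simp add: \<rho>_def)
    qed
    ultimately show ?thesis
      using bound[OF a] \<delta> e by auto
  qed
  moreover have "fstar < min r (fstar + \<delta>)" using \<delta> assms(7) by simp
  ultimately have "\<exists>V rhat. open V \<and> V \<noteq> {} \<and> fstar < rhat \<and>
      (\<forall>x \<in> V \<inter> {x. ereal fstar < f x \<and> f x < ereal rhat}.
         edist_to x {y. f y \<le> ereal fstar}
           \<le> ereal (\<alpha> powr (1 / \<theta>) / (1 - \<theta>)) * epowr (slope f x) ((1 - \<theta>) / \<theta>))"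
    using \<rho> by (intro exI[of _ "ball x0 \<rho>"] exI[of _ "min r (fstar + \<delta>)"]) auto
  moreover have "edist_to x {y. f y \<le> ereal fstar}
      \<le> ereal (\<alpha> powr (1 / \<theta>) / (1 - \<theta>)) * epowr (slope f x) ((1 - \<theta>) / \<theta>)"
    if "U = UNIV" "ereal fstar < f x" "f x < ereal r" for x
  proof -
    from that(2,3) obtain a where a: "f x = ereal (fstar + a)" "0 < a" "fstar + a < r"
      using finite_value by blast
    show ?thesis
      \<comment> \<open>Every ball lies in \<open>UNIV\<close>, so any radius above
        \<open>?D a\<close> will do and \<open>r\<close> need not shrink.\<close>
      by (rule bound[OF a, of "?D a + 1"]) (auto simp: that(1))
  qed
  ultimately show ?thesis by blast
qed

end
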